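(* Let $m\ge1$ and let $X=(X_t)_{t\in\mathbb{Z}^m}$ be a (strictly) stationary real-valued random field with $E[|X_0|^q]<\infty$ for some $q>1$. If $m=1$, then for all $h\in\mathbb{R}^+$, $$\theta(h)\le 2^{\frac{2q-1}{q}}\,(\alpha(h))^{\frac{q-1}{q}}\,\|X_0\|_q .$$ Moreover, for all $m\ge1$ and all $h\in\mathbb{R}^+$, $$\theta(h)\le 2^{\frac{2q-1}{q}}\,(\alpha_{\infty,1}(h))^{\frac{q-1}{q}}\,\|X_0\|_q .$$
   Context: $\mathbb{R}^+=[0,\infty)$ and $\|\cdot\|_q$ is the $L^q$-norm. Lexicographic order: for distinct $y,z\in\mathbb{Z}^m$, $y<_{lex}z$ iff $y_1<z_1$, or for some $p\in\{2,\dots,m\}$ one has $y_p<z_p$ and $y_q=z_q$ for $q=1,\dots,p-1$. $V_t=\{s\in\mathbb{Z}^m: s<_{lex}t\}\cup\{t\}$ and $V_t^h=V_t\cap\{s:\|t-s\|_\infty\ge h\}$. $\theta$-lex-coefficients: let $\mathcal{G}^*_u$ be the bounded Borel functions $\mathbb{R}^u\to\mathbb{R}$ and $\mathcal{G}_1$ the bounded (globally) Lipschitz functions $\mathbb{R}\to\mathbb{R}$, with Lipschitz constant $Lip(G)$. For $\Gamma=(i_1,\dots,i_u)$ write $X_\Gamma=(X_{i_1},\dots,X_{i_u})$. Then $\theta(h)=\sup_{u\in\mathbb{N}}\theta_u(h)$ with $$\theta_u(h)=\sup\Big\{\frac{|Cov(F(X_\Gamma),G(X_j))|}{\|F\|_\infty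 Lip(G)}: F\in\mathcal{G}_u^*,\,G\in\mathcal{G}_1,\,j\in\mathbb{Z}^m,\,\Gamma\subset V_j^h,\,|\Gamma|=u\Big\},$$ the supremum being over $F,G$ with non-zero denominator. Mixing coefficients: for sub-$\sigma$-algebras $\mathcal{M},\mathcal{V}$, $\alpha(\mathcal{M},\mathcal{V})=\sup\{|P(M)P(V)-P(M\cap V)|: M\in\mathcal{M},V\in\mathcal{V}\}$. For $u,v\in\mathbb{N}\cup\{\infty\}$, $$\alpha_{u,v}(h)=\sup\{\alpha(\sigma(X_\Gamma),\sigma(X_{\tilde\Gamma})):\Gamma,\tilde\Gamma\subset\mathbb{Z}^m,\ |\Gamma|\le u,\ |\tilde\Gamma|\le v,\ dist(\Gamma,\tilde\Gamma)\ge h\},$$ where $dist(\Gamma,\tilde\Gamma)=\inf_{i\in\Gamma,j\in\tilde\Gamma}\|i-j\|_\infty$. For $m=1$, $\alpha(h)=\alpha(\sigma(\{X_s,s\le0\}),\sigma(\{X_s,s\ge h\}))$. *)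

theory Defs
  imports
    "HOL-Probability.Probability"
    "HOL-Library.Extended_Nat"
    "HOL-Library.Fun_Lexorder"
begin

text \<open>
  The lattice \<open>\<int>\<^sup>m\<close> is \<^typ>\<open>int ^ 'm\<close> for a finite linearly ordered index type
  \<open>'m\<close> with \<open>CARD('m) = m\<close>; the linear order on \<open>'m\<close> numbers the coordinates.
\<close>

definition strictly_stationary ::
    "'a measure \<Rightarrow> (int ^ 'm \<Rightarrow> 'a \<Rightarrow> real) \<Rightarrow> bool" where
  "strictly_stationary M X \<longleftrightarrow>
    (\<forall>J \<tau>. finite J \<longrightarrow>
      distr M (PiM J (\<lambda>_. borel)) (\<lambda>\<omega>. \<lambda>t\<in>J. X (t + \<tau>) \<omega>) =
      distr M (PiM J (\<lambda>_. borel)) (\<lambda>\<omega>. \<lambda>t\<in>J. X t \<omega>))"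

definition Lq_norm :: "real \<Rightarrow> 'a measure \<Rightarrow> ('a \<Rightarrow> real) \<Rightarrow> real" where
  "Lq_norm q M Y = (\<integral>\<omega>. \<bar>Y \<omega>\<bar> powr q \<partial>M) powr (1 / q)"

definition covariance :: "'a measure \<Rightarrow> ('a \<Rightarrow> real) \<Rightarrow> ('a \<Rightarrow> real) \<Rightarrow> real" where
  "covariance M Y Z =
    (\<integral>\<omega>. (Y \<omega> - (\<integral>\<omega>'. Y \<omega>' \<partial>M)) * (Z \<omega> - (\<integral>\<omega>'. Z \<omega>' \<partial>M)) \<partial>M)"


definition lattice_norm :: "int ^ 'm \<Rightarrow> real" where
  "lattice_norm t = real_of_int (Max (range (\<lambda>i. \<bar>t $ i\<bar>)))"

definition lex_less :: "(int, 'm::{finite,linorder}) vec \<Rightarrow> (int, 'm) vec \<Rightarrow> bool" where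
  "lex_less y z \<longleftrightarrow> less_fun (\<lambda>p. y $ p) (\<lambda>p. z $ p)"

definition lex_past :: "(int, 'm::{finite,linorder}) vec \<Rightarrow> (int, 'm) vec set" where
  "lex_past t = {s. lex_less s t} \<union> {t}"

definition lex_past_far :: "(int, 'm::{finite,linorder}) vec \<Rightarrow> real \<Rightarrow> (int, 'm) vec set" where
  "lex_past_far t h = lex_past t \<inter> {s. lattice_norm (t - s) \<ge> h}"


text \<open>
  \<open>\<real>\<^sup>u\<close>, with its Borel \<open>\<sigma>\<close>-algebra, is the product space over the coordinates
  \<open>{..<u}\<close>; its points are functions that are \<^const>\<open>undefined\<close> off \<open>{..<u}\<close>.
\<close>

abbreviation borel_power :: "nat \<Rightarrow> (nat \<Rightarrow> real) measure" where
  "borel_power u \<equiv> PiM {..<u} (\<lambda>_. borel)"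

definition bounded_borel :: "nat \<Rightarrow> ((nat \<Rightarrow> real) \<Rightarrow> real) set" where
  "bounded_borel u =
    {F \<in> borel_measurable (borel_power u). bounded (F ` space (borel_power u))}"

definition sup_norm :: "nat \<Rightarrow> ((nat \<Rightarrow> real) \<Rightarrow> real) \<Rightarrow> real" where
  "sup_norm u F = (SUP x\<in>space (borel_power u). \<bar>F x\<bar>)"

definition bounded_lipschitz :: "(real \<Rightarrow> real) set" where
  "bounded_lipschitz = {G. bounded (range G) \<and> (\<exists>L. L-lipschitz_on UNIV G)}"

definition Lip :: "(real \<Rightarrow> real) \<Rightarrow> real" where
  "Lip G = (SUP (x, y)\<in>{(x, y). x \<noteq> y}. \<bar>G x - G y\<bar> / \<bar>x - y\<bar>)"

definition field_tuple :: "('i \<Rightarrow> 'a \<Rightarrow> real) \<Rightarrow> 'i list \<Rightarrow> 'a \<Rightarrow> nat \<Rightarrow> real" where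
  "field_tuple X \<Gamma> \<omega> = (\<lambda>k\<in>{..<length \<Gamma>}. X (\<Gamma> ! k) \<omega>)"

text \<open>
  The suprema defining the \<open>\<theta>\<close>-coefficients are taken in \<^typ>\<open>ennreal\<close>, so that they
  are meaningful without knowing beforehand that they are finite.
\<close>

definition theta_lex_u ::
    "'a measure \<Rightarrow> ((int, 'm::{finite,linorder}) vec \<Rightarrow> 'a \<Rightarrow> real) \<Rightarrow> nat \<Rightarrow> real \<Rightarrow> ennreal" where
  "theta_lex_u M X u h =
    Sup {ennreal (\<bar>covariance M (\<lambda>\<omega>. F (field_tuple X \<Gamma> \<omega>)) (\<lambda>\<omega>. G (X j \<omega>))\<bar>
                    / (sup_norm u F * Lip G))
         | F G j \<Gamma>.
           F \<in> bounded_borel u \<and> G \<in> bounded_lipschitz \<and> sup_norm u F * Lip G \<noteq> 0 \<and>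
           distinct \<Gamma> \<and> length \<Gamma> = u \<and> set \<Gamma> \<subseteq> lex_past_far j h}"

definition theta_lex ::
    "'a measure \<Rightarrow> ((int, 'm::{finite,linorder}) vec \<Rightarrow> 'a \<Rightarrow> real) \<Rightarrow> real \<Rightarrow> ennreal" where
  "theta_lex M X h = (SUP u\<in>{1..}. theta_lex_u M X u h)"


definition alpha_mixing :: "'a measure \<Rightarrow> 'a set set \<Rightarrow> 'a set set \<Rightarrow> real" where
  "alpha_mixing P \<M> \<V> =
    (SUP (A, B)\<in>\<M> \<times> \<V>. \<bar>measure P A * measure P B - measure P (A \<inter> B)\<bar>)"

definition sigma_field :: "'a measure \<Rightarrow> ('i \<Rightarrow> 'a \<Rightarrow> real) \<Rightarrow> 'i set \<Rightarrow> 'a set set" where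
  "sigma_field M X \<Gamma> =
    sets (vimage_algebra (space M) (\<lambda>\<omega>. \<lambda>t\<in>\<Gamma>. X t \<omega>) (PiM \<Gamma> (\<lambda>_. borel)))"

definition ecard :: "'b set \<Rightarrow> enat" where
  "ecard A = (if finite A then enat (card A) else \<infinity>)"

definition lattice_dist :: "(int ^ 'm) set \<Rightarrow> (int ^ 'm) set \<Rightarrow> ennreal" where
  "lattice_dist \<Gamma> \<Gamma>' = (INF i\<in>\<Gamma>. INF j\<in>\<Gamma>'. ennreal (lattice_norm (i - j)))"

definition alpha_field ::
    "'a measure \<Rightarrow> (int ^ 'm \<Rightarrow> 'a \<Rightarrow> real) \<Rightarrow> enat \<Rightarrow> enat \<Rightarrow> real \<Rightarrow> real" where
  "alpha_field M X u v h =
    (SUP (\<Gamma>, \<Gamma>')\<in>{(\<Gamma>, \<Gamma>'). ecard \<Gamma> \<le> u \<and> ecard \<Gamma>' \<le> v \<and> lattice_dist \<Gamma> \<Gamma>' \<ge> ennreal h}.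
      alpha_mixing M (sigma_field M X \<Gamma>) (sigma_field M X \<Gamma>'))"

definition alpha_process :: "'a measure \<Rightarrow> (int \<Rightarrow> 'a \<Rightarrow> real) \<Rightarrow> real \<Rightarrow> real" where
  "alpha_process M Y h =
    alpha_mixing M (sigma_field M Y {s. s \<le> 0}) (sigma_field M Y {s. real_of_int s \<ge> h})"

end

theory Submission
  imports Defs
begin

text \<open>
  Both bounds are one covariance inequality, applied to \<open>f = F(X\<^bsub>\<Gamma>\<^esub>)\<close> and \<open>Y = G(X\<^bsub>j\<^esub>) - G(0)\<close>.
  Let \<open>f\<close> be measurable for a \<open>\<sigma>\<close>-algebra \<open>A\<close> and bounded by \<open>K\<close>, let \<open>Y\<close> be measurable
  for \<open>B\<close>, and put \<open>Z = E(f - Ef | B)\<close>. Then \<open>Cov(f, Y) = E(Z Y)\<close>, so Hoelder's inequality with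
  \<open>p = q / (q - 1)\<close> gives \<open>\<bar>Cov(f, Y)\<bar> \<le> \<parallel>Z\<parallel>\<^sub>p \<parallel>Y\<parallel>\<^sub>q\<close>. Two estimates control
  \<open>\<parallel>Z\<parallel>\<^sub>p\<close>: trivially \<open>\<bar>Z\<bar> \<le> 2K\<close>, and \<open>E\<bar>Z\<bar> \<le> 4K \<alpha>(A, B)\<close>. Interpolating between them,
  \<open>\<parallel>Z\<parallel>\<^sub>p \<le> ((2K)\<^sup>p\<^sup>-\<^sup>1 4K\<alpha>)\<^bsup>1/p\<^esup> = 2\<^bsup>1+1/p\<^esup> K \<alpha>\<^bsup>1/p\<^esup>\<close>, and \<open>1 + 1/p = (2q - 1)/q\<close> is
  the exponent in the theorem. This is \<open>covariance_le_alpha_mixing\<close>.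

  The bound on \<open>E\<bar>Z\<bar>\<close> (\<open>L1_norm_cond_exp_centered_le\<close>) comes from replacing first \<open>Z\<close> and then
  \<open>f\<close> by signs: \<open>E\<bar>Z\<bar>\<close> is the covariance of \<open>f\<close> with the sign \<open>\<eta>\<close> of \<open>Z\<close>, which is
  \<open>B\<close>-measurable; the same argument with the roles exchanged bounds it by \<open>K\<close> times the
  covariance of \<open>\<eta>\<close> with an \<open>A\<close>-measurable sign; and two \<open>\<plusminus>1\<close>-valued functions that are
  \<open>1\<close> exactly on \<open>S\<close> and \<open>T\<close> have covariance \<open>4 (P(S \<inter> T) - P(S) P(T))\<close>.

  Subtracting the constant \<open>G(0)\<close> does not change the covariance and makes
  \<open>\<bar>Y\<bar> \<le> Lip(G) \<bar>X\<^bsub>j\<^esub>\<bar>\<close>; by stationarity \<open>X\<^bsub>j\<^esub>\<close> has the norm of \<open>X\<^sub>0\<close>. In the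
  spatial bound \<open>\<Gamma>\<close> and \<open>{j}\<close> themselves compete in the supremum defining
  \<open>\<alpha>\<^bsub>\<infinity>,1\<^esub>(h)\<close>. In dimension one, the field is translated so that \<open>j\<close> moves to
  \<open>\<lceil>h\<rceil>\<close>; then \<open>\<Gamma>\<close> moves into the nonpositive integers, and the covariance is unchanged because
  it depends only on the joint law of finitely many variables.
\<close>

section \<open>Hoelder's inequality for \<open>L\<^sup>q\<close>-norms\<close>

lemma Lq_norm_nonneg: "0 \<le> Lq_norm q M f"
  by (simp add: Lq_norm_def)

lemma Holder_integrable_mult:
  fixes f g :: "'a \<Rightarrow> real"
  assumes "p > 1" "q > 1" "1 / p + 1 / q = 1"
    and [measurable]: "f \<in> borel_measurable M" "g \<in> borel_measurable M"
    and f: "integrable M (\<lambda>x. \<bar>f x\<bar> powr p)" and g: "integrable M (\<lambda>x. \<bar>g x\<bar> powr q)"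
  shows "integrable M (\<lambda>x. f x * g x)"
proof (rule Bochner_Integration.integrable_bound)
  show "integrable M (\<lambda>x. \<bar>f x\<bar> powr p / p + \<bar>g x\<bar> powr q / q)"
    using f g by simp
  have "norm (f x * g x) \<le> norm (\<bar>f x\<bar> powr p / p + \<bar>g x\<bar> powr q / q)" for x
    using Youngs_inequality[OF assms(1-3), of "\<bar>f x\<bar>" "\<bar>g x\<bar>"] by (simp add: abs_mult)
  then show "AE x in M. norm (f x * g x) \<le> norm (\<bar>f x\<bar> powr p / p + \<bar>g x\<bar> powr q / q)"
    by simp
qed simp

lemma AE_eq_zero_if_integral_powr_eq_zero:
  fixes f :: "'a \<Rightarrow> real"
  assumes "integrable M (\<lambda>x. \<bar>f x\<bar> powr p)" "(\<integral>x. \<bar>f x\<bar> powr p \<partial>M) = 0"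
  shows "AE x in M. f x = 0"
  using integral_nonneg_eq_0_iff_AE[OF assms(1)] assms(2) by simp

text \<open>
  Integrate Young's inequality after scaling both functions to norm one. The scaling is
  impossible when a norm vanishes, but then the product is zero almost everywhere.
\<close>

lemma Holder_inequality:
  fixes f g :: "'a \<Rightarrow> real"
  assumes pq: "p > 1" "q > 1" "1 / p + 1 / q = 1"
    and [measurable]: "f \<in> borel_measurable M" "g \<in> borel_measurable M"
    and f: "integrable M (\<lambda>x. \<bar>f x\<bar> powr p)" and g: "integrable M (\<lambda>x. \<bar>g x\<bar> powr q)"
  shows "(\<integral>x. \<bar>f x * g x\<bar> \<partial>M) \<le> Lq_norm p M f * Lq_norm q M g"
proof -
  define A where "A = (\<integral>x. \<bar>f x\<bar> powr p \<partial>M)"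
  define B where "B = (\<integral>x. \<bar>g x\<bar> powr q \<partial>M)"
  have nonneg: "0 \<le> A" "0 \<le> B"
    by (simp_all add: A_def B_def)
  show ?thesis
  proof (cases "A = 0 \<or> B = 0")
    case True
    then have "AE x in M. \<bar>f x * g x\<bar> = 0"
      using AE_eq_zero_if_integral_powr_eq_zero[OF f] AE_eq_zero_if_integral_powr_eq_zero[OF g]
      by (auto simp: A_def B_def)
    then have "(\<integral>x. \<bar>f x * g x\<bar> \<partial>M) = (\<integral>x. 0 \<partial>M)"
      by (intro integral_cong_AE) simp_all
    then show ?thesis
      by (simp add: Lq_norm_nonneg)
  next
    case False
    then have pos: "A > 0" "B > 0"
      using nonneg by auto
    define a where "a = A powr (1 / p)"
    define b where "b = B powr (1 / q)"
    have ab: "a > 0" "b > 0" "a powr p = A" "b powr q = B"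
      using pos pq by (auto simp: a_def b_def powr_powr)
    have "(\<integral>x. \<bar>f x * g x\<bar> \<partial>M) / (a * b) = (\<integral>x. (\<bar>f x\<bar> / a) * (\<bar>g x\<bar> / b) \<partial>M)"
      by (simp add: abs_mult)
    also have "\<dots> \<le> (\<integral>x. \<bar>f x\<bar> powr p / (A * p) + \<bar>g x\<bar> powr q / (B * q) \<partial>M)"
    proof (rule integral_mono)
      show "integrable M (\<lambda>x. (\<bar>f x\<bar> / a) * (\<bar>g x\<bar> / b))"
        using integrable_abs[OF Holder_integrable_mult[OF assms]] by (simp add: abs_mult)
      show "integrable M (\<lambda>x. \<bar>f x\<bar> powr p / (A * p) + \<bar>g x\<bar> powr q / (B * q))"
        using f g by simp
      show "(\<bar>f x\<bar> / a) * (\<bar>g x\<bar> / b) \<le> \<bar>f x\<bar> powr p / (A * p) + \<bar>g x\<bar> powr q / (B * q)" for x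
        using Youngs_inequality[OF pq, of "\<bar>f x\<bar> / a" "\<bar>g x\<bar> / b"] ab
        by (simp add: powr_divide)
    qed
    also have "\<dots> = A / (A * p) + B / (B * q)"
      using f g by (simp add: A_def B_def)
    also have "\<dots> = 1"
      using pos pq by simp
    finally show ?thesis
      using ab by (simp add: Lq_norm_def a_def b_def A_def B_def divide_simps)
  qed
qed

section \<open>The covariance inequality\<close>

lemma (in prob_space) abs_prob_mult_diff_le_1: "\<bar>prob A * prob B - prob (A \<inter> B)\<bar> \<le> 1"
proof -
  have "0 \<le> prob A * prob B" "prob A * prob B \<le> 1"
    by (simp_all add: mult_le_one)
  then show ?thesis
    using measure_nonneg[of M "A \<inter> B"] prob_le_1[of "A \<inter> B"] by linarith
qed

lemma (in prob_space) alpha_mixing_upper: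
  assumes "A \<in> \<M>" "B \<in> \<V>"
  shows "\<bar>prob A * prob B - prob (A \<inter> B)\<bar> \<le> alpha_mixing M \<M> \<V>"
  unfolding alpha_mixing_def
  by (rule cSUP_upper2[where x = "(A, B)"])
     (use assms in \<open>auto intro!: bdd_aboveI[where M = 1] simp: abs_prob_mult_diff_le_1\<close>)

lemma (in prob_space) alpha_mixing_nonneg:
  assumes "{} \<in> \<M>" "{} \<in> \<V>"
  shows "0 \<le> alpha_mixing M \<M> \<V>"
  using alpha_mixing_upper[OF assms] by simp

lemma (in prob_space) alpha_mixing_le_1:
  assumes "\<M> \<noteq> {}" "\<V> \<noteq> {}"
  shows "alpha_mixing M \<M> \<V> \<le> 1"
  unfolding alpha_mixing_def
  by (rule cSUP_least) (use assms in \<open>auto simp: abs_prob_mult_diff_le_1\<close>)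

lemma (in prob_space) covariance_eq:
  assumes "integrable M f" "integrable M g" "integrable M (\<lambda>x. f x * g x)"
  shows "covariance M f g = expectation (\<lambda>x. f x * g x) - expectation f * expectation g"
proof -
  have "(\<lambda>x. (f x - expectation f) * (g x - expectation g)) =
      (\<lambda>x. f x * g x - f x * expectation g - expectation f * g x + expectation f * expectation g)"
    by (auto simp: algebra_simps)
  then show ?thesis
    using assms by (simp add: covariance_def prob_space)
qed

text \<open>
  The sign of a function \<open>g\<close>, when \<open>S = {x. g x \<ge> 0}\<close>. It is \<open>1\<close> rather than \<open>0\<close> where \<open>g\<close> vanishes, so
  that the covariance of two signs is a multiple of the single quantity \<open>P(S \<inter> T) - P(S) P(T)\<close>.
\<close>

definition sign_of :: "'a set \<Rightarrow> 'a \<Rightarrow> real" where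
  "sign_of S x = 2 * indicator S x - 1"

lemma abs_sign_of [simp]: "\<bar>sign_of S x\<bar> = 1"
  by (simp add: sign_of_def indicator_def)

lemma borel_measurable_sign_of [measurable]:
  assumes [measurable]: "S \<in> sets N"
  shows "sign_of S \<in> borel_measurable N"
proof -
  have "(\<lambda>x. 2 * indicator S x - 1 :: real) \<in> borel_measurable N"
    by measurable
  then show ?thesis
    by (simp add: sign_of_def[abs_def])
qed

lemma (in prob_space) integrable_bounded_mult:
  fixes f g :: "'a \<Rightarrow> real"
  assumes "f \<in> borel_measurable M" "\<And>x. x \<in> space M \<Longrightarrow> \<bar>f x\<bar> \<le> K" "integrable M g"
  shows "integrable M (\<lambda>x. f x * g x)"
proof (rule Bochner_Integration.integrable_bound)
  show "integrable M (\<lambda>x. K * g x)"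
    using assms by simp
  have "norm (f x * g x) \<le> norm (K * g x)" if "x \<in> space M" for x
  proof -
    have "\<bar>f x\<bar> \<le> \<bar>K\<bar>"
      using assms(2)[OF that] by linarith
    then show ?thesis
      by (simp add: abs_mult mult_right_mono)
  qed
  then show "AE x in M. norm (f x * g x) \<le> norm (K * g x)"
    by simp
qed (use assms in measurable)

lemma (in prob_space) integrable_bounded:
  fixes f :: "'a \<Rightarrow> real"
  assumes "f \<in> borel_measurable M" "\<And>x. x \<in> space M \<Longrightarrow> \<bar>f x\<bar> \<le> K"
  shows "integrable M f"
  using integrable_bounded_mult[OF assms, of "\<lambda>_. 1"] by simp

lemma (in prob_space) integrable_sign_of [simp]:
  "S \<in> sets M \<Longrightarrow> integrable M (sign_of S)"
  by (rule integrable_bounded[where K = 1]) auto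

lemma (in prob_space) expectation_sign_of:
  assumes "S \<in> sets M"
  shows "expectation (sign_of S) = 2 * prob S - 1"
proof -
  have "expectation (sign_of S) = (\<integral>x. 2 * indicator S x - 1 \<partial>M)"
    by (intro Bochner_Integration.integral_cong) (auto simp: sign_of_def)
  also have "\<dots> = 2 * prob S - 1"
    using assms by (simp add: prob_space less_top[symmetric])
  finally show ?thesis .
qed

lemma (in prob_space) covariance_sign_of:
  assumes [measurable]: "S \<in> sets M" "T \<in> sets M"
  shows "covariance M (sign_of S) (sign_of T) = 4 * (prob (S \<inter> T) - prob S * prob T)"
proof -
  have "expectation (\<lambda>x. sign_of S x * sign_of T x) =
      (\<integral>x. 4 * indicator (S \<inter> T) x - 2 * indicator S x - 2 * indicator T x + 1 \<partial>M)"
    by (intro Bochner_Integration.integral_cong) (auto simp: sign_of_def indicator_def)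
  also have "\<dots> = 4 * prob (S \<inter> T) - 2 * prob S - 2 * prob T + 1"
    by (simp add: prob_space less_top[symmetric])
  finally have "expectation (\<lambda>x. sign_of S x * sign_of T x) = \<dots>" .
  moreover have "integrable M (\<lambda>x. sign_of S x * sign_of T x)"
    by (rule integrable_bounded_mult[where K = 1]) auto
  ultimately show ?thesis
    by (simp add: covariance_eq expectation_sign_of algebra_simps)
qed

text \<open>
  The sign of \<open>E(f | A)\<close> is itself \<open>A\<close>-measurable, so multiplying by it commutes with the
  conditional expectation.
\<close>

lemma (in prob_space) L1_norm_cond_exp_sign:
  assumes A: "subalgebra M A" and f: "integrable M f"
  obtains S where "S \<in> sets A"
    "(\<integral>x. \<bar>real_cond_exp M A f x\<bar> \<partial>M) = (\<integral>x. sign_of S x * f x \<partial>M)"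
proof -
  interpret A: finite_measure_subalgebra M A
    by unfold_locales (rule A)
  define S where "S = {x \<in> space A. real_cond_exp M A f x \<ge> 0}"
  have S [measurable]: "S \<in> sets A"
    unfolding S_def by measurable
  have "S \<in> sets M"
    using S A by (auto simp: subalgebra_def)
  have "(\<integral>x. \<bar>real_cond_exp M A f x\<bar> \<partial>M) = (\<integral>x. sign_of S x * real_cond_exp M A f x \<partial>M)"
    using A by (intro Bochner_Integration.integral_cong)
      (auto simp: sign_of_def S_def subalgebra_def indicator_def)
  also have "\<dots> = (\<integral>x. sign_of S x * f x \<partial>M)"
  proof (rule A.real_cond_exp_intg(2))
    show "integrable M (\<lambda>x. sign_of S x * f x)"
      using \<open>S \<in> sets M\<close> f by (intro integrable_bounded_mult[where K = 1]) auto
  qed (use f in auto)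
  finally show thesis
    using S by (rule that[rotated])
qed

text \<open>
  Among the \<open>A\<close>-measurable functions bounded by \<open>K\<close>, none correlates
  with \<open>g\<close> more than \<open>K\<close> times the sign of \<open>E(g | A)\<close>.
\<close>

lemma (in prob_space) expectation_mult_le_L1_norm_cond_exp:
  assumes A: "subalgebra M A" and f [measurable]: "f \<in> borel_measurable A"
    and K: "\<And>x. x \<in> space M \<Longrightarrow> \<bar>f x\<bar> \<le> K" and g: "integrable M g"
  shows "expectation (\<lambda>x. f x * g x) \<le> K * (\<integral>x. \<bar>real_cond_exp M A g x\<bar> \<partial>M)"
proof -
  interpret A: finite_measure_subalgebra M A
    by unfold_locales (rule A)
  have fM: "f \<in> borel_measurable M"
    by (rule measurable_from_subalg[OF A f])
  note c = A.real_cond_exp_intg[OF integrable_bounded_mult[OF fM K g] f borel_measurable_integrable[OF g]]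
  have "expectation (\<lambda>x. f x * g x) = expectation (\<lambda>x. f x * real_cond_exp M A g x)"
    by (rule c(2)[symmetric])
  also have "\<dots> \<le> expectation (\<lambda>x. K * \<bar>real_cond_exp M A g x\<bar>)"
  proof (rule integral_mono)
    fix x assume "x \<in> space M"
    then have "\<bar>f x * real_cond_exp M A g x\<bar> \<le> K * \<bar>real_cond_exp M A g x\<bar>"
      by (simp add: abs_mult K mult_right_mono)
    then show "f x * real_cond_exp M A g x \<le> K * \<bar>real_cond_exp M A g x\<bar>"
      by linarith
  qed (use c(1) A.real_cond_exp_int(1)[OF g] in auto)
  finally show ?thesis
    by simp
qed

lemma (in prob_space) expectation_mult_centered:
  assumes "integrable M f" "integrable M g" "integrable M (\<lambda>x. f x * g x)"
  shows "expectation (\<lambda>x. (f x - expectation f) * g x) = covariance M f g"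
    and "expectation (\<lambda>x. f x * (g x - expectation g)) = covariance M f g"
  using assms by (simp_all add: covariance_eq algebra_simps)

text \<open>
  The left-hand side is the covariance of \<open>f\<close> with a \<open>B\<close>-measurable sign. Conditioning that sign
  on \<open>A\<close> shows that \<open>f\<close> may in turn be replaced by \<open>K\<close> times an \<open>A\<close>-measurable sign, and
  the covariance of two signs is at most \<open>4 \<alpha>\<close>.
\<close>

lemma (in prob_space) L1_norm_cond_exp_centered_le:
  assumes A: "subalgebra M A" and B: "subalgebra M B"
    and f: "f \<in> borel_measurable A"
    and K: "\<And>x. x \<in> space M \<Longrightarrow> \<bar>f x\<bar> \<le> K"
  shows "(\<integral>x. \<bar>real_cond_exp M B (\<lambda>x. f x - expectation f) x\<bar> \<partial>M)
          \<le> 4 * K * alpha_mixing M (sets A) (sets B)"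
proof -
  have fM: "f \<in> borel_measurable M"
    by (rule measurable_from_subalg[OF A f])
  have intf: "integrable M f"
    by (rule integrable_bounded[OF fM K])
  have "K \<ge> 0"
    using K not_empty abs_ge_zero order_trans by blast
  obtain T where T: "T \<in> sets B"
    "(\<integral>x. \<bar>real_cond_exp M B (\<lambda>x. f x - expectation f) x\<bar> \<partial>M)
      = (\<integral>x. sign_of T x * (f x - expectation f) \<partial>M)"
    by (rule L1_norm_cond_exp_sign[OF B, of "\<lambda>x. f x - expectation f"]) (use intf in auto)
  have TM: "T \<in> sets M"
    using T(1) B by (auto simp: subalgebra_def)
  define \<eta> where "\<eta> = (\<lambda>x. sign_of T x - expectation (sign_of T))"
  have int\<eta>: "integrable M \<eta>"
    unfolding \<eta>_def using TM by simp
  obtain S where S: "S \<in> sets A"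
    "(\<integral>x. \<bar>real_cond_exp M A \<eta> x\<bar> \<partial>M) = (\<integral>x. sign_of S x * \<eta> x \<partial>M)"
    by (rule L1_norm_cond_exp_sign[OF A int\<eta>])
  have SM: "S \<in> sets M"
    using S(1) A by (auto simp: subalgebra_def)
  have "(\<integral>x. sign_of T x * (f x - expectation f) \<partial>M) = covariance M f (sign_of T)"
    using expectation_mult_centered(1)[OF intf integrable_sign_of[OF TM]]
      integrable_bounded_mult[OF fM K integrable_sign_of[OF TM]]
    by (simp add: mult.commute)
  also have "\<dots> = (\<integral>x. f x * \<eta> x \<partial>M)"
    unfolding \<eta>_def
    using expectation_mult_centered(2)[OF intf integrable_sign_of[OF TM]]
      integrable_bounded_mult[OF fM K integrable_sign_of[OF TM]] by simp
  also have "\<dots> \<le> K * (\<integral>x. sign_of S x * \<eta> x \<partial>M)"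
    using expectation_mult_le_L1_norm_cond_exp[OF A f K int\<eta>] S(2) by simp
  also have "\<dots> \<le> K * (4 * alpha_mixing M (sets A) (sets B))"
  proof (rule mult_left_mono)
    have "(\<integral>x. sign_of S x * \<eta> x \<partial>M) = covariance M (sign_of S) (sign_of T)"
      unfolding \<eta>_def
      by (rule expectation_mult_centered(2))
         (use SM TM in \<open>auto intro!: integrable_bounded_mult[where K = 1]\<close>)
    then show "(\<integral>x. sign_of S x * \<eta> x \<partial>M) \<le> 4 * alpha_mixing M (sets A) (sets B)"
      using alpha_mixing_upper[OF S(1) T(1)] covariance_sign_of[OF SM TM] by (simp add: abs_le_iff)
  qed fact
  finally show ?thesis
    by (simp only: T(2) mult_ac)
qed

lemma (in prob_space) integrable_if_integrable_powr:
  fixes Y :: "'a \<Rightarrow> real"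
  assumes "q \<ge> 1" "Y \<in> borel_measurable M" "integrable M (\<lambda>x. \<bar>Y x\<bar> powr q)"
  shows "integrable M Y"
proof (rule Bochner_Integration.integrable_bound)
  show "integrable M (\<lambda>x. 1 + \<bar>Y x\<bar> powr q)"
    using assms by simp
  have "\<bar>y\<bar> \<le> 1 + \<bar>y\<bar> powr q" for y :: real
  proof (cases "\<bar>y\<bar> \<le> 1")
    case False
    then show ?thesis
      using powr_mono[of 1 q "\<bar>y\<bar>"] assms(1) by simp
  qed (simp add: add_increasing2)
  then show "AE x in M. norm (Y x) \<le> norm (1 + \<bar>Y x\<bar> powr q)"
    by simp
qed (use assms in simp)

text \<open>
  Interpolation between \<open>L\<^sup>1\<close> and \<open>L\<^sup>\<infinity>\<close>, from \<open>\<bar>Z\<bar>\<^sup>p \<le> C\<^sup>p\<^sup>-\<^sup>1 \<bar>Z\<bar>\<close>.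
\<close>

lemma Lq_norm_le_interpolation:
  fixes Z :: "'a \<Rightarrow> real"
  assumes "p \<ge> 1" "integrable M Z" "AE x in M. \<bar>Z x\<bar> \<le> C"
  shows "integrable M (\<lambda>x. \<bar>Z x\<bar> powr p)"
    and "Lq_norm p M Z \<le> (C powr (p - 1) * (\<integral>x. \<bar>Z x\<bar> \<partial>M)) powr (1 / p)"
proof -
  have *: "\<bar>z\<bar> powr p \<le> C powr (p - 1) * \<bar>z\<bar>" if "\<bar>z\<bar> \<le> C" for z
  proof (cases "z = 0")
    case False
    then have "\<bar>z\<bar> powr p = \<bar>z\<bar> powr (p - 1) * \<bar>z\<bar>"
      using powr_add[of "\<bar>z\<bar>" "p - 1" 1] by simp
    then show ?thesis
      using that assms(1) by (simp add: mult_right_mono powr_mono2)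
  qed simp
  have AE: "AE x in M. \<bar>Z x\<bar> powr p \<le> C powr (p - 1) * \<bar>Z x\<bar>"
    using assms(3) by eventually_elim (rule *)
  have int: "integrable M (\<lambda>x. C powr (p - 1) * \<bar>Z x\<bar>)"
    using assms(2) by simp
  show int': "integrable M (\<lambda>x. \<bar>Z x\<bar> powr p)"
    by (rule Bochner_Integration.integrable_bound[OF int]) (use AE assms(2) in auto)
  have "(\<integral>x. \<bar>Z x\<bar> powr p \<partial>M) \<le> C powr (p - 1) * (\<integral>x. \<bar>Z x\<bar> \<partial>M)"
    using integral_mono_AE[OF int' int AE] by simp
  then show "Lq_norm p M Z \<le> (C powr (p - 1) * (\<integral>x. \<bar>Z x\<bar> \<partial>M)) powr (1 / p)"
    unfolding Lq_norm_def using assms(1) by (intro powr_mono2) auto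
qed

text \<open>
  Conditioning on \<open>B\<close> before applying Hoelder's inequality is what brings in \<open>\<alpha>\<close>: the
  conditional expectation \<open>Z\<close> of the centred \<open>f\<close> is small in \<open>L\<^sup>1\<close>, whereas \<open>f\<close> itself is only
  bounded.
\<close>

theorem (in prob_space) covariance_le_alpha_mixing:
  assumes A: "subalgebra M A" and B: "subalgebra M B"
    and f: "f \<in> borel_measurable A"
    and K: "\<And>x. x \<in> space M \<Longrightarrow> \<bar>f x\<bar> \<le> K"
    and Y: "Y \<in> borel_measurable B"
    and q: "q > 1" and Yq: "integrable M (\<lambda>x. \<bar>Y x\<bar> powr q)"
  shows "\<bar>covariance M f Y\<bar> \<le> 2 powr ((2 * q - 1) / q)
           * alpha_mixing M (sets A) (sets B) powr ((q - 1) / q) * K * Lq_norm q M Y"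
proof -
  interpret B: finite_measure_subalgebra M B
    by unfold_locales (rule B)
  define p where "p = q / (q - 1)"
  have pq: "p > 1" "1 / p = (q - 1) / q" "1 / p + 1 / q = 1" "(2 * q - 1) / q = 1 + 1 / p"
    using q by (auto simp: p_def field_simps)
  define \<alpha> where "\<alpha> = alpha_mixing M (sets A) (sets B)"
  have "\<alpha> \<ge> 0"
    by (simp add: \<alpha>_def alpha_mixing_nonneg)
  have "K \<ge> 0"
    using K not_empty abs_ge_zero order_trans by blast
  have fM: "f \<in> borel_measurable M" and YM: "Y \<in> borel_measurable M"
    using measurable_from_subalg[OF A f] measurable_from_subalg[OF B Y] by auto
  have intf: "integrable M f"
    by (rule integrable_bounded[OF fM K])
  have intY: "integrable M Y"
    using integrable_if_integrable_powr[OF _ YM Yq] q by simp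
  define f0 where "f0 = (\<lambda>x. f x - expectation f)"
  have intf0: "integrable M f0"
    unfolding f0_def using intf by simp
  have intYf0: "integrable M (\<lambda>x. Y x * f0 x)"
    unfolding f0_def using integrable_bounded_mult[OF fM K intY] intY by (simp add: algebra_simps)
  have "\<bar>expectation f\<bar> \<le> K"
  proof -
    have "\<bar>expectation f\<bar> \<le> expectation (\<lambda>x. \<bar>f x\<bar>)"
      by simp
    also have "\<dots> \<le> expectation (\<lambda>_. K)"
      by (rule integral_mono) (use intf K in auto)
    finally show ?thesis
      by (simp add: prob_space)
  qed
  then have bound: "\<bar>f0 x\<bar> \<le> 2 * K" if "x \<in> space M" for x
    using K[OF that] by (simp add: f0_def)
  define Z where "Z = real_cond_exp M B f0"
  have ZB: "Z \<in> borel_measurable M" and intZ: "integrable M Z"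
    unfolding Z_def using B.real_cond_exp_int(1)[OF intf0] by auto
  have "AE x in M. Z x \<ge> - (2 * K)" "AE x in M. Z x \<le> 2 * K"
    unfolding Z_def by (rule B.real_cond_exp_ge_c B.real_cond_exp_le_c;
        use intf0 bound in \<open>force simp: abs_le_iff\<close>)+
  then have AEZ: "AE x in M. \<bar>Z x\<bar> \<le> 2 * K"
    by eventually_elim simp
  note Zp = Lq_norm_le_interpolation[OF less_imp_le[OF pq(1)] intZ AEZ]
  have "\<bar>covariance M f Y\<bar> = \<bar>expectation (\<lambda>x. Y x * f0 x)\<bar>"
    unfolding f0_def
    using expectation_mult_centered(1)[OF intf intY integrable_bounded_mult[OF fM K intY]]
    by (simp add: mult.commute)
  also have "\<dots> = \<bar>expectation (\<lambda>x. Z x * Y x)\<bar>"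
    using B.real_cond_exp_intg(2)[OF intYf0 Y borel_measurable_integrable[OF intf0]]
    by (simp add: Z_def mult.commute)
  also have "\<dots> \<le> expectation (\<lambda>x. \<bar>Z x * Y x\<bar>)"
    by simp
  also have "\<dots> \<le> Lq_norm p M Z * Lq_norm q M Y"
    using Holder_inequality[OF pq(1) q pq(3) ZB YM _ Yq] Zp(1) by simp
  also have "\<dots> \<le> (2 powr ((2 * q - 1) / q) * \<alpha> powr ((q - 1) / q) * K) * Lq_norm q M Y"
  proof (rule mult_right_mono)
    \<comment> \<open>Of the factor \<open>4 K \<alpha>\<close>, a factor \<open>2 K\<close> completes the power \<open>(2 K)\<^sup>p\<close>; the remaining
      \<open>2 \<alpha>\<close> contributes \<open>2\<^bsup>1/p\<^esup> \<alpha>\<^bsup>1/p\<^esup>\<close>.\<close>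
    have "Lq_norm p M Z \<le> ((2 * K) powr (p - 1) * (\<integral>x. \<bar>Z x\<bar> \<partial>M)) powr (1 / p)"
      by (rule Zp(2))
    also have "\<dots> \<le> ((2 * K) powr (p - 1) * (4 * K * \<alpha>)) powr (1 / p)"
      using L1_norm_cond_exp_centered_le[OF A B f K] pq(1)
      by (intro powr_mono2 mult_left_mono) (auto simp: Z_def f0_def \<alpha>_def)
    also have "(2 * K) powr (p - 1) * (4 * K * \<alpha>) = (2 * K) powr p * (2 * \<alpha>)"
      using powr_add[of "2 * K" "p - 1" 1] \<open>K \<ge> 0\<close> by (cases "K = 0") auto
    also have "((2 * K) powr p * (2 * \<alpha>)) powr (1 / p) = 2 * K * 2 powr (1 / p) * \<alpha> powr (1 / p)"
      using pq(1) \<open>K \<ge> 0\<close> \<open>\<alpha> \<ge> 0\<close> by (simp add: powr_mult powr_powr)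
    also have "\<dots> = 2 powr ((2 * q - 1) / q) * \<alpha> powr ((q - 1) / q) * K"
      unfolding pq(4) pq(2)[symmetric] by (simp add: powr_add)
    finally show "Lq_norm p M Z \<le> 2 powr ((2 * q - 1) / q) * \<alpha> powr ((q - 1) / q) * K" .
  qed (rule Lq_norm_nonneg)
  finally show ?thesis
    by (simp add: \<alpha>_def)
qed

section \<open>Covariances of a random field\<close>

text \<open>
  The measure space behind \<^const>\<open>sigma_field\<close>, which is only a set of sets; conditional
  expectations need the former.
\<close>

abbreviation field_algebra :: "'a measure \<Rightarrow> ('i \<Rightarrow> 'a \<Rightarrow> real) \<Rightarrow> 'i set \<Rightarrow> 'a measure" where
  "field_algebra M X \<Gamma> \<equiv>
    vimage_algebra (space M) (\<lambda>\<omega>. \<lambda>t\<in>\<Gamma>. X t \<omega>) (PiM \<Gamma> (\<lambda>_. borel))"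

lemma sets_field_algebra: "sets (field_algebra M X \<Gamma>) = sigma_field M X \<Gamma>"
  by (simp add: sigma_field_def)

lemma subalgebra_field_algebra:
  assumes "\<And>t. X t \<in> borel_measurable M"
  shows "subalgebra M (field_algebra M X \<Gamma>)"
  unfolding subalgebra_def
proof
  have "(\<lambda>\<omega>. \<lambda>t\<in>\<Gamma>. X t \<omega>) \<in> M \<rightarrow>\<^sub>M PiM \<Gamma> (\<lambda>_. borel)"
    by (intro measurable_restrict assms)
  then show "sets (field_algebra M X \<Gamma>) \<subseteq> sets M"
    by (intro sets_image_in_sets) auto
qed simp

lemma borel_measurable_field_algebra:
  assumes "t \<in> \<Gamma>"
  shows "X t \<in> borel_measurable (field_algebra M X \<Gamma>)"
proof -
  have "(\<lambda>\<omega>. \<lambda>t\<in>\<Gamma>. X t \<omega>) \<in> field_algebra M X \<Gamma> \<rightarrow>\<^sub>M PiM \<Gamma> (\<lambda>_. borel)"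
    by (rule measurable_vimage_algebra1) (auto simp: space_PiM)
  from measurable_compose[OF this measurable_component_singleton[OF assms]]
  show ?thesis
    using assms by simp
qed

lemma measurable_field_tuple:
  assumes "\<And>t. t \<in> set \<Gamma> \<Longrightarrow> X t \<in> borel_measurable N"
  shows "field_tuple X \<Gamma> \<in> N \<rightarrow>\<^sub>M borel_power (length \<Gamma>)"
  unfolding field_tuple_def[abs_def] by (rule measurable_restrict) (use assms in auto)

lemma abs_le_sup_norm:
  assumes "F \<in> bounded_borel u" "x \<in> space (borel_power u)"
  shows "\<bar>F x\<bar> \<le> sup_norm u F"
proof -
  obtain B where "\<And>y. y \<in> space (borel_power u) \<Longrightarrow> \<bar>F y\<bar> \<le> B"
    using assms(1) by (auto simp: bounded_borel_def bounded_iff)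
  then show ?thesis
    unfolding sup_norm_def using assms(2) by (intro cSUP_upper bdd_aboveI[where M = B]) auto
qed

lemma sup_norm_nonneg: "F \<in> bounded_borel u \<Longrightarrow> 0 \<le> sup_norm u F"
  using abs_le_sup_norm[of F u "\<lambda>_\<in>{..<u}. 0"] by (force simp: space_PiM)

lemma abs_diff_le_Lip:
  assumes "G \<in> bounded_lipschitz"
  shows "\<bar>G x - G y\<bar> \<le> Lip G * \<bar>x - y\<bar>"
proof (cases "x = y")
  case False
  obtain L where L: "L-lipschitz_on UNIV G"
    using assms by (auto simp: bounded_lipschitz_def)
  have "\<bar>G a - G b\<bar> / \<bar>a - b\<bar> \<le> L" if "a \<noteq> b" for a b
    using lipschitz_onD[OF L, of a b] that by (simp add: dist_real_def divide_simps)
  then have "bdd_above ((\<lambda>(x, y). \<bar>G x - G y\<bar> / \<bar>x - y\<bar>) ` {(x, y). x \<noteq> y})"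
    by (auto intro!: bdd_aboveI[where M = L])
  then have "\<bar>G x - G y\<bar> / \<bar>x - y\<bar> \<le> Lip G"
    unfolding Lip_def using False by (intro cSUP_upper2[where x = "(x, y)"]) auto
  then show ?thesis
    using False by (simp add: divide_simps)
qed simp

lemma Lip_nonneg: "G \<in> bounded_lipschitz \<Longrightarrow> 0 \<le> Lip G"
  using abs_diff_le_Lip[of G 1 0] by simp

lemma borel_measurable_bounded_lipschitz:
  assumes "G \<in> bounded_lipschitz"
  shows "G \<in> borel_measurable borel"
proof -
  obtain L where "L-lipschitz_on UNIV G"
    using assms by (auto simp: bounded_lipschitz_def)
  then show ?thesis
    by (intro borel_measurable_continuous_onI lipschitz_on_continuous_on)
qed

lemma (in prob_space) covariance_diff_const:
  assumes "integrable M g"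
  shows "covariance M f (\<lambda>x. g x - c) = covariance M f g"
  using assms by (simp add: covariance_def prob_space)

lemma Lq_norm_lipschitz_le:
  fixes Y :: "'a \<Rightarrow> real"
  assumes G: "G \<in> bounded_lipschitz" and q: "q > 0"
    and Y: "Y \<in> borel_measurable M" and Yq: "integrable M (\<lambda>x. \<bar>Y x\<bar> powr q)"
  shows "integrable M (\<lambda>x. \<bar>G (Y x) - G 0\<bar> powr q)"
    and "Lq_norm q M (\<lambda>x. G (Y x) - G 0) \<le> Lip G * Lq_norm q M Y"
proof -
  have GY [measurable]: "(\<lambda>x. G (Y x)) \<in> borel_measurable M"
    by (rule measurable_compose[OF Y borel_measurable_bounded_lipschitz[OF G]])
  have le: "\<bar>G (Y x) - G 0\<bar> powr q \<le> Lip G powr q * \<bar>Y x\<bar> powr q" for x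
  proof -
    have "\<bar>G (Y x) - G 0\<bar> powr q \<le> (Lip G * \<bar>Y x\<bar>) powr q"
      using abs_diff_le_Lip[OF G, of "Y x" 0] q by (intro powr_mono2) auto
    then show ?thesis
      by (simp add: powr_mult Lip_nonneg[OF G])
  qed
  have int: "integrable M (\<lambda>x. Lip G powr q * \<bar>Y x\<bar> powr q)"
    using Yq by simp
  show int': "integrable M (\<lambda>x. \<bar>G (Y x) - G 0\<bar> powr q)"
    by (rule Bochner_Integration.integrable_bound[OF int]) (use le in auto)
  have "Lq_norm q M (\<lambda>x. G (Y x) - G 0) \<le> (Lip G powr q * (\<integral>x. \<bar>Y x\<bar> powr q \<partial>M)) powr (1 / q)"
    unfolding Lq_norm_def using integral_mono[OF int' int le] q by (intro powr_mono2) auto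
  also have "\<dots> = Lip G * Lq_norm q M Y"
    using q Lip_nonneg[OF G] by (simp add: powr_mult powr_powr Lq_norm_def)
  finally show "Lq_norm q M (\<lambda>x. G (Y x) - G 0) \<le> Lip G * Lq_norm q M Y" .
qed

text \<open>
  The index type and the sets \<open>S \<supseteq> \<Gamma>\<close> and \<open>T\<close> containing \<open>j\<close> are left free because the two bounds
  choose them differently: the one-dimensional bound uses the half-lines of integers, the spatial one
  \<open>set \<Gamma>\<close> and \<open>{j}\<close> in the lattice.
\<close>

lemma (in prob_space) covariance_field_le_alpha_mixing:
  fixes X :: "'i \<Rightarrow> 'a \<Rightarrow> real"
  assumes X: "\<And>t. X t \<in> borel_measurable M"
    and \<Gamma>: "set \<Gamma> \<subseteq> S" and j: "j \<in> T"
    and F: "F \<in> bounded_borel (length \<Gamma>)" and G: "G \<in> bounded_lipschitz"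
    and q: "q > 1" and Xq: "integrable M (\<lambda>\<omega>. \<bar>X j \<omega>\<bar> powr q)"
  shows "\<bar>covariance M (\<lambda>\<omega>. F (field_tuple X \<Gamma> \<omega>)) (\<lambda>\<omega>. G (X j \<omega>))\<bar>
    \<le> 2 powr ((2 * q - 1) / q)
        * alpha_mixing M (sigma_field M X S) (sigma_field M X T) powr ((q - 1) / q)
        * Lq_norm q M (X j) * (sup_norm (length \<Gamma>) F * Lip G)"
proof -
  let ?A = "field_algebra M X S" and ?B = "field_algebra M X T"
  let ?f = "\<lambda>\<omega>. F (field_tuple X \<Gamma> \<omega>)" and ?Y = "\<lambda>\<omega>. G (X j \<omega>) - G 0"
  let ?C = "2 powr ((2 * q - 1) / q)
        * alpha_mixing M (sigma_field M X S) (sigma_field M X T) powr ((q - 1) / q)"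
  have f: "?f \<in> borel_measurable ?A"
    by (rule measurable_compose[OF measurable_field_tuple])
       (use \<Gamma> F in \<open>auto intro: borel_measurable_field_algebra simp: bounded_borel_def\<close>)
  have K: "\<bar>?f \<omega>\<bar> \<le> sup_norm (length \<Gamma>) F" for \<omega>
    by (rule abs_le_sup_norm[OF F]) (simp add: field_tuple_def space_PiM)
  have GB: "(\<lambda>\<omega>. G (X j \<omega>)) \<in> borel_measurable ?B"
    by (rule measurable_compose[OF borel_measurable_field_algebra[OF j]
          borel_measurable_bounded_lipschitz[OF G]])
  then have Y: "?Y \<in> borel_measurable ?B"
    by simp
  obtain b where b: "\<And>x. \<bar>G x\<bar> \<le> b"
    using G by (auto simp: bounded_lipschitz_def bounded_iff)
  have intG: "integrable M (\<lambda>\<omega>. G (X j \<omega>))"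
    by (rule integrable_bounded[OF measurable_from_subalg[OF subalgebra_field_algebra[OF X] GB] b])
  note lip = Lq_norm_lipschitz_le[OF G _ X Xq]
  have "\<bar>covariance M ?f (\<lambda>\<omega>. G (X j \<omega>))\<bar> = \<bar>covariance M ?f ?Y\<bar>"
    by (simp add: covariance_diff_const[OF intG])
  also have "\<dots> \<le> ?C * sup_norm (length \<Gamma>) F * Lq_norm q M ?Y"
    using covariance_le_alpha_mixing[OF subalgebra_field_algebra[OF X]
        subalgebra_field_algebra[OF X] f K Y q lip(1)] q
    by (simp only: sets_field_algebra)
  also have "\<dots> \<le> ?C * sup_norm (length \<Gamma>) F * (Lip G * Lq_norm q M (X j))"
    using lip(2) q sup_norm_nonneg[OF F] by (intro mult_left_mono) auto
  finally show ?thesis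
    by (simp add: mult_ac)
qed

section \<open>Stationarity\<close>

lemma covariance_distr:
  assumes h: "h \<in> M \<rightarrow>\<^sub>M N" and f: "f \<in> borel_measurable N" and g: "g \<in> borel_measurable N"
  shows "covariance (distr M N h) f g = covariance M (\<lambda>x. f (h x)) (\<lambda>x. g (h x))"
  unfolding covariance_def using f g by (simp add: integral_distr[OF h])

text \<open>
  Both factors are functions of the field restricted to the finite set \<open>\<Gamma> \<union> {j}\<close>, whose law
  stationarity makes translation invariant. Using the union as index set, and not \<open>\<Gamma>\<close> next to a
  separate \<open>j\<close>, covers \<open>j \<in> \<Gamma>\<close>, which occurs for \<open>h = 0\<close>.
\<close>

lemma covariance_shift:
  fixes X :: "int ^ 'm \<Rightarrow> 'a \<Rightarrow> real"
  assumes X: "\<And>t. X t \<in> borel_measurable M" and stat: "strictly_stationary M X"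
    and F: "F \<in> borel_measurable (borel_power (length \<Gamma>))" and G: "G \<in> borel_measurable borel"
  shows "covariance M (\<lambda>\<omega>. F (field_tuple X (map (\<lambda>t. t + \<tau>) \<Gamma>) \<omega>)) (\<lambda>\<omega>. G (X (j + \<tau>) \<omega>))
       = covariance M (\<lambda>\<omega>. F (field_tuple X \<Gamma> \<omega>)) (\<lambda>\<omega>. G (X j \<omega>))"
proof -
  define J where "J = insert j (set \<Gamma>)"
  define f where "f = (\<lambda>x. F (\<lambda>k\<in>{..<length \<Gamma>}. x (\<Gamma> ! k)))"
  define g where "g = (\<lambda>x. G (x j))"
  let ?N = "PiM J (\<lambda>_. borel :: real measure)"
  have f: "f \<in> borel_measurable ?N"
    unfolding f_def
    by (rule measurable_compose[OF measurable_restrict F])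
       (auto simp: J_def intro!: measurable_component_singleton)
  have g: "g \<in> borel_measurable ?N"
    unfolding g_def
    by (rule measurable_compose[OF _ G]) (simp add: J_def)
  have cov: "covariance (distr M ?N (\<lambda>\<omega>. \<lambda>t\<in>J. X (t + \<sigma>) \<omega>)) f g
      = covariance M (\<lambda>\<omega>. F (field_tuple X (map (\<lambda>t. t + \<sigma>) \<Gamma>) \<omega>)) (\<lambda>\<omega>. G (X (j + \<sigma>) \<omega>))" for \<sigma>
  proof -
    have "f (\<lambda>t\<in>J. X (t + \<sigma>) \<omega>) = F (field_tuple X (map (\<lambda>t. t + \<sigma>) \<Gamma>) \<omega>)" for \<omega>
      unfolding f_def field_tuple_def
      by (intro arg_cong[where f = F]) (auto simp: J_def fun_eq_iff)
    moreover have "g (\<lambda>t\<in>J. X (t + \<sigma>) \<omega>) = G (X (j + \<sigma>) \<omega>)" for \<omega>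
      by (simp add: g_def J_def)
    ultimately show ?thesis
      by (subst covariance_distr[OF _ f g]) (auto intro!: measurable_restrict X)
  qed
  have "finite J"
    by (simp add: J_def)
  then have "distr M ?N (\<lambda>\<omega>. \<lambda>t\<in>J. X (t + \<tau>) \<omega>) = distr M ?N (\<lambda>\<omega>. \<lambda>t\<in>J. X (t + 0) \<omega>)"
    using stat by (simp add: strictly_stationary_def)
  then show ?thesis
    using cov[of \<tau>] cov[of 0] by simp
qed

lemma stationary_distr_eq:
  fixes X :: "int ^ 'm \<Rightarrow> 'a \<Rightarrow> real"
  assumes X: "\<And>t. X t \<in> borel_measurable M" and stat: "strictly_stationary M X"
  shows "distr M borel (X t) = distr M borel (X 0)"
proof -
  let ?J = "{0 :: int ^ 'm}"
  let ?N = "PiM ?J (\<lambda>_. borel :: real measure)"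
  have "distr M borel (X s) = distr (distr M ?N (\<lambda>\<omega>. \<lambda>r\<in>?J. X (r + s) \<omega>)) borel (\<lambda>x. x 0)" for s
    by (subst distr_distr) (auto intro!: measurable_restrict X simp: comp_def)
  moreover have "distr M ?N (\<lambda>\<omega>. \<lambda>r\<in>?J. X (r + t) \<omega>) = distr M ?N (\<lambda>\<omega>. \<lambda>r\<in>?J. X (r + 0) \<omega>)"
    using stat by (simp add: strictly_stationary_def)
  ultimately show ?thesis
    by simp
qed

lemma stationary_powr_moments:
  fixes X :: "int ^ 'm \<Rightarrow> 'a \<Rightarrow> real"
  assumes X: "\<And>t. X t \<in> borel_measurable M" and stat: "strictly_stationary M X"
  shows "integrable M (\<lambda>\<omega>. \<bar>X t \<omega>\<bar> powr q) \<longleftrightarrow> integrable M (\<lambda>\<omega>. \<bar>X 0 \<omega>\<bar> powr q)"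
    and "Lq_norm q M (X t) = Lq_norm q M (X 0)"
proof -
  have m: "(\<lambda>x::real. \<bar>x\<bar> powr q) \<in> borel_measurable borel"
    by measurable
  note eq = stationary_distr_eq[OF X stat, of t]
  show "integrable M (\<lambda>\<omega>. \<bar>X t \<omega>\<bar> powr q) \<longleftrightarrow> integrable M (\<lambda>\<omega>. \<bar>X 0 \<omega>\<bar> powr q)"
    using integrable_distr_eq[OF X m, of t] integrable_distr_eq[OF X m, of 0] eq by simp
  show "Lq_norm q M (X t) = Lq_norm q M (X 0)"
    using integral_distr[OF X m, of t] integral_distr[OF X m, of 0] eq by (simp add: Lq_norm_def)
qed

section \<open>The two bounds on the coefficients\<close>

text \<open>
  The normalising factor of each quotient in the supremum is positive, so a bound on \<open>\<theta>(h)\<close> is a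
  bound on covariances.
\<close>

lemma theta_lex_le:
  fixes X :: "(int, 'm::{finite,linorder}) vec \<Rightarrow> 'a \<Rightarrow> real"
  assumes "\<And>F G j (\<Gamma> :: (int, 'm) vec list). F \<in> bounded_borel (length \<Gamma>) \<Longrightarrow> G \<in> bounded_lipschitz
      \<Longrightarrow> set \<Gamma> \<subseteq> lex_past_far j h
      \<Longrightarrow> \<bar>covariance M (\<lambda>\<omega>. F (field_tuple X \<Gamma> \<omega>)) (\<lambda>\<omega>. G (X j \<omega>))\<bar>
            \<le> C * (sup_norm (length \<Gamma>) F * Lip G)"
  shows "theta_lex M X h \<le> ennreal C"
  unfolding theta_lex_def theta_lex_u_def
proof (intro SUP_least Sup_least, clarify)
  fix F G j and \<Gamma> :: "(int, 'm) vec list"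
  assume F: "F \<in> bounded_borel (length \<Gamma>)" and G: "G \<in> bounded_lipschitz"
    and "sup_norm (length \<Gamma>) F * Lip G \<noteq> 0" and \<Gamma>: "set \<Gamma> \<subseteq> lex_past_far j h"
  then have "sup_norm (length \<Gamma>) F * Lip G > 0"
    using sup_norm_nonneg[OF F] Lip_nonneg[OF G] by (simp add: less_le)
  then show "ennreal (\<bar>covariance M (\<lambda>\<omega>. F (field_tuple X \<Gamma> \<omega>)) (\<lambda>\<omega>. G (X j \<omega>))\<bar>
      / (sup_norm (length \<Gamma>) F * Lip G)) \<le> ennreal C"
    using assms[OF F G \<Gamma>] by (intro ennreal_leI) (simp add: pos_divide_le_eq)
qed

lemma lattice_norm_minus_commute: "lattice_norm (s - t) = lattice_norm (t - s)"
  by (simp add: lattice_norm_def abs_minus_commute)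

lemma (in prob_space) alpha_mixing_le_alpha_field:
  assumes "ecard \<Gamma> \<le> u" "ecard \<Gamma>' \<le> v" "lattice_dist \<Gamma> \<Gamma>' \<ge> ennreal h"
  shows "alpha_mixing M (sigma_field M X \<Gamma>) (sigma_field M X \<Gamma>') \<le> alpha_field M X u v h"
proof -
  have "alpha_mixing M (sigma_field M X A) (sigma_field M X B) \<le> 1" for A B
    by (rule alpha_mixing_le_1) (use sets.empty_sets in \<open>auto simp: sigma_field_def\<close>)
  then show ?thesis
    unfolding alpha_field_def using assms
    by (intro cSUP_upper2[where x = "(\<Gamma>, \<Gamma>')"] bdd_aboveI[where M = 1]) auto
qed

text \<open>
  The distance condition on \<open>\<Gamma>\<close> makes the pair \<open>(\<Gamma>, {j})\<close> admissible in the supremum defining \<open>\<alpha>\<^bsub>\<infinity>,1\<^esub>(h)\<close>.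
\<close>

lemma (in prob_space) theta_lex_le_alpha_field:
  fixes X :: "int ^ 'm::{finite,linorder} \<Rightarrow> 'a \<Rightarrow> real"
  assumes X: "\<And>t. X t \<in> borel_measurable M" and stat: "strictly_stationary M X"
    and q: "q > 1" and Xq: "integrable M (\<lambda>\<omega>. \<bar>X 0 \<omega>\<bar> powr q)"
  shows "theta_lex M X h \<le> ennreal (2 powr ((2 * q - 1) / q)
           * alpha_field M X \<infinity> 1 h powr ((q - 1) / q) * Lq_norm q M (X 0))"
proof (rule theta_lex_le)
  fix F G j and \<Gamma> :: "(int, 'm) vec list"
  assume F: "F \<in> bounded_borel (length \<Gamma>)" and G: "G \<in> bounded_lipschitz"
    and \<Gamma>: "set \<Gamma> \<subseteq> lex_past_far j h"
  let ?\<alpha> = "alpha_mixing M (sigma_field M X (set \<Gamma>)) (sigma_field M X {j})"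
  have "lattice_dist (set \<Gamma>) {j} \<ge> ennreal h"
    unfolding lattice_dist_def using \<Gamma>
    by (intro INF_greatest ennreal_leI) (auto simp: lex_past_far_def lattice_norm_minus_commute)
  then have \<alpha>: "?\<alpha> \<le> alpha_field M X \<infinity> 1 h"
    by (intro alpha_mixing_le_alpha_field) (auto simp: ecard_def one_enat_def)
  have "?\<alpha> \<ge> 0"
    by (rule alpha_mixing_nonneg) (simp_all add: sigma_field_def)
  have "\<bar>covariance M (\<lambda>\<omega>. F (field_tuple X \<Gamma> \<omega>)) (\<lambda>\<omega>. G (X j \<omega>))\<bar>
      \<le> 2 powr ((2 * q - 1) / q) * ?\<alpha> powr ((q - 1) / q)
        * Lq_norm q M (X 0) * (sup_norm (length \<Gamma>) F * Lip G)"
    using covariance_field_le_alpha_mixing[of X, OF X subset_refl singletonI[of j] F G q]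
      stationary_powr_moments[OF X stat, where t = j and q = q] Xq by simp
  also have "\<dots> \<le> 2 powr ((2 * q - 1) / q) * alpha_field M X \<infinity> 1 h powr ((q - 1) / q)
        * Lq_norm q M (X 0) * (sup_norm (length \<Gamma>) F * Lip G)"
    using \<alpha> \<open>?\<alpha> \<ge> 0\<close> q sup_norm_nonneg[OF F] Lip_nonneg[OF G]
    by (intro mult_right_mono mult_left_mono powr_mono2) (auto simp: Lq_norm_nonneg)
  finally show "\<bar>covariance M (\<lambda>\<omega>. F (field_tuple X \<Gamma> \<omega>)) (\<lambda>\<omega>. G (X j \<omega>))\<bar> \<le> \<dots>" .
qed

text \<open>
  Coordinates are integers, so a distance of at least \<open>h\<close> is one of at least \<open>\<lceil>h\<rceil>\<close>.
\<close>

lemma lex_past_far_one_dim: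
  fixes s t :: "(int, 'm::{finite,linorder}) vec"
  assumes UNIV: "(UNIV :: 'm set) = {i}" and s: "s \<in> lex_past_far t h"
  shows "s $ i \<le> t $ i - \<lceil>h\<rceil>"
proof -
  have all: "k = i" for k
    using UNIV by auto
  have "s $ i \<le> t $ i"
    using s all by (auto simp: lex_past_far_def lex_past_def lex_less_def less_fun_def)
       (metis less_imp_le)
  moreover have "h \<le> real_of_int \<bar>t $ i - s $ i\<bar>"
    using s by (simp add: lex_past_far_def lattice_norm_def UNIV)
  ultimately have "h \<le> real_of_int (t $ i - s $ i)"
    by simp
  then have "\<lceil>h\<rceil> \<le> t $ i - s $ i"
    by (simp only: ceiling_le_iff)
  then show ?thesis
    by simp
qed

text \<open>
  Translating \<open>j\<close> to \<open>\<lceil>h\<rceil>\<close>, the least integer of the future half-line, moves \<open>\<Gamma>\<close> into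
  the past half-line.
\<close>

lemma (in prob_space) theta_lex_le_alpha_process:
  fixes X :: "int ^ 'm::{finite,linorder} \<Rightarrow> 'a \<Rightarrow> real"
  assumes card: "CARD('m) = 1"
    and X: "\<And>t. X t \<in> borel_measurable M" and stat: "strictly_stationary M X"
    and q: "q > 1" and Xq: "integrable M (\<lambda>\<omega>. \<bar>X 0 \<omega>\<bar> powr q)"
  shows "theta_lex M X h \<le> ennreal (2 powr ((2 * q - 1) / q)
           * alpha_process M (\<lambda>s. X (vec s)) h powr ((q - 1) / q) * Lq_norm q M (X 0))"
proof (rule theta_lex_le)
  fix F G j and \<Gamma> :: "(int, 'm) vec list"
  assume F: "F \<in> bounded_borel (length \<Gamma>)" and G: "G \<in> bounded_lipschitz"
    and \<Gamma>: "set \<Gamma> \<subseteq> lex_past_far j h"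
  obtain i where UNIV: "(UNIV :: 'm set) = {i}"
    using card by (rule card_1_singletonE)
  define Y where "Y = (\<lambda>s. X (vec s))"
  define \<tau> where "\<tau> = vec \<lceil>h\<rceil> - j"
  define \<Delta> where "\<Delta> = map (\<lambda>t. (t + \<tau>) $ i) \<Gamma>"
  have vec: "vec (t $ i) = t" for t :: "(int, 'm) vec"
    using UNIV by (auto simp: vec_eq_iff)
  have length: "length \<Delta> = length \<Gamma>"
    by (simp add: \<Delta>_def)
  have past: "set \<Delta> \<subseteq> {s. s \<le> 0}"
    using \<Gamma> lex_past_far_one_dim[OF UNIV, of _ j h] by (fastforce simp: \<Delta>_def \<tau>_def)
  have tuple: "field_tuple X (map (\<lambda>t. t + \<tau>) \<Gamma>) = field_tuple Y \<Delta>"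
    by (auto simp: field_tuple_def \<Delta>_def Y_def vec fun_eq_iff simp del: vector_add_component)
  have point: "X (j + \<tau>) = Y \<lceil>h\<rceil>"
    by (simp add: \<tau>_def Y_def)
  have Y: "Y s \<in> borel_measurable M" for s
    unfolding Y_def by (rule X)
  have Yq: "integrable M (\<lambda>\<omega>. \<bar>Y \<lceil>h\<rceil> \<omega>\<bar> powr q)"
    and norm: "Lq_norm q M (Y \<lceil>h\<rceil>) = Lq_norm q M (X 0)"
    unfolding Y_def using stationary_powr_moments[OF X stat] Xq by auto
  have "covariance M (\<lambda>\<omega>. F (field_tuple X \<Gamma> \<omega>)) (\<lambda>\<omega>. G (X j \<omega>))
      = covariance M (\<lambda>\<omega>. F (field_tuple Y \<Delta> \<omega>)) (\<lambda>\<omega>. G (Y \<lceil>h\<rceil> \<omega>))"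
    using covariance_shift[OF X stat _ borel_measurable_bounded_lipschitz[OF G], of F \<Gamma> \<tau> j] F
    by (simp add: tuple point bounded_borel_def)
  also have "\<bar>\<dots>\<bar> \<le> 2 powr ((2 * q - 1) / q) * alpha_process M Y h powr ((q - 1) / q)
        * Lq_norm q M (X 0) * (sup_norm (length \<Gamma>) F * Lip G)"
    unfolding alpha_process_def
    using covariance_field_le_alpha_mixing[of Y \<Delta> "{s. s \<le> 0}" "\<lceil>h\<rceil>" "{s. real_of_int s \<ge> h}",
        OF Y past _ _ G q Yq] F by (simp add: length norm le_of_int_ceiling)
  finally show "\<bar>covariance M (\<lambda>\<omega>. F (field_tuple X \<Gamma> \<omega>)) (\<lambda>\<omega>. G (X j \<omega>))\<bar>
      \<le> 2 powr ((2 * q - 1) / q) * alpha_process M (\<lambda>s. X (vec s)) h powr ((q - 1) / q)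
        * Lq_norm q M (X 0) * (sup_norm (length \<Gamma>) F * Lip G)"
    by (simp add: Y_def)
qed

theorem proposition2p5:
  fixes M :: "'a measure"
    and X :: "int ^ 'm::{finite,linorder} \<Rightarrow> 'a \<Rightarrow> real"
    and q :: real
  assumes "prob_space M"
    and "\<And>t. X t \<in> borel_measurable M"
    and "strictly_stationary M X"
    and "q > 1"
    and "integrable M (\<lambda>\<omega>. \<bar>X 0 \<omega>\<bar> powr q)"
  shows "(CARD('m) = 1 \<longrightarrow>
            (\<forall>h\<ge>0. theta_lex M X h \<le>
              ennreal (2 powr ((2 * q - 1) / q)
                * alpha_process M (\<lambda>s. X (vec s)) h powr ((q - 1) / q)
                * Lq_norm q M (X 0))))
       \<and> (\<forall>h\<ge>0. theta_lex M X h \<le>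
            ennreal (2 powr ((2 * q - 1) / q)
              * alpha_field M X \<infinity> 1 h powr ((q - 1) / q)
              * Lq_norm q M (X 0)))"
  using prob_space.theta_lex_le_alpha_process[OF assms(1) _ assms(2-5)]
    prob_space.theta_lex_le_alpha_field[OF assms] by blast

end
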